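(* Let $n=3$ with dependent variables $(u^1,u^2,u^3)=(u,v,w)$, and consider the bi-Hamiltonian pair $$A=\begin{pmatrix}0&0&1\\ 0&1&0\\ 1&0&0\end{pmatrix}\partial_x,$$ $$B=\begin{pmatrix}\frac{v^3}{w^2}&-\frac{3v^2}{2w}&-v+1\\ -\frac{3v^2}{2w}&2v+1&w\\ -v+1&w&0\end{pmatrix}\partial_x+\begin{pmatrix}0&1&0\\ -1&0&0\\ 0&0&0\end{pmatrix}u_x+\begin{pmatrix}\frac{3v^2}{2w^2}&0&0\\ -\frac{3v}{w}&1&0\\ -1&0&0\end{pmatrix}v_x+\begin{pmatrix}-\frac{v^3}{w^3}&0&0\\ \frac{3v^2}{2w^2}&0&0\\ 0&1&0\end{pmatrix}w_x+\begin{pmatrix}\partial_x^{-1}&0&0\\ 0&0&0\\ 0&0&0\end{pmatrix}.$$ Then the non-homogeneous hydrodynamic type system associated with the pair $A,B$, $$u_t=-\frac{3v^2}{2w^2}v_x+\frac{v^3}{w^3}w_x-x,\qquad v_t=u_x+\frac{3v}{w}v_x-\frac{3v^2}{2w^2}w_x,\qquad w_t=v_x,$$ is obtained by applying the operator $B$ to (minus) the Casimir $u$ of the operator $A$; precisely, this system can be written as $$\begin{pmatrix} u \\ v \\ w \end{pmatrix}_t^{\,i}=A^{ij}\frac{\delta \mathbf F}{\delta u^j}=B^{ij}\frac{\delta \mathbf L}{\delta u^j},$$ where $$\mathbf L=-\int u\,dx,\qquad \mathbf F=\int\left(uv+\frac{v^3}{2w}-\frac{x^2}{2}w\right)dx.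$$
   Context: $u,v,w$ are functions of $(t,x)$ with $w\ne0$. For a functional $\mathbf H=\int h(x,u,v,w)\,dx$ whose density does not depend on derivatives, $\frac{\delta\mathbf H}{\delta u^j}=\frac{\partial h}{\partial u^j}$. The inverse derivative of the constant function is normalized by $\partial_x^{-1}1=x$. A Casimir of $A$ is a density $h$ with $A^{ij}\frac{\delta}{\delta u^j}\int h\,dx=0$ for all $i$. A bi-Hamiltonian pair is a pair of Hamiltonian operators all of whose linear combinations $B+\lambda A$ are Hamiltonian. *)

theory Defs
  imports "HOL-Analysis.Analysis"
begin

section \<open>Nonlocal operators of hydrodynamic type\<close>

text \<open>
  The inverse derivative is
  \<open>(1/2) (\<integral>_{-\<infinity>}^x f - \<integral>_x^\<infinity> f)\<close>, with both improper integrals cut off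
  symmetrically at \<open>-R\<close> and \<open>R\<close>. This choice is skew-adjoint on compactly supported functions,
  and it maps the constant function 1 to \<open>x\<close>.
\<close>

definition dx_inv :: "(real \<Rightarrow> real) \<Rightarrow> real \<Rightarrow> real" where
  "dx_inv f x = Lim at_top (\<lambda>R. (integral {-R..x} f - integral {x..R} f) / 2)"

text \<open>
  A field is a function of \<open>x\<close>; its values are the vectors \<open>(u\<^sup>1, u\<^sup>2, u\<^sup>3) = (u, v, w)\<close>.
  An operator takes a field and a covector field, and is linear in the latter. The matrix operator
  \<open>g\<^sup>i\<^sup>j(U) \<partial>\<^sub>x + b\<^sup>i\<^sup>j\<^sub>k(U) U\<^sup>k\<^sub>x + c\<^sup>i\<^sup>j \<partial>\<^sub>x\<^sup>-\<^sup>1\<close> is given by its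
  coefficient matrices, \<open>b k\<close> being the one that multiplies the derivative of \<open>U\<^sup>k\<close>.
\<close>

type_synonym field = "real \<Rightarrow> real ^ 3"
type_synonym field_operator = "field \<Rightarrow> field \<Rightarrow> field"

definition hydro_operator ::
  "(real ^ 3 \<Rightarrow> real ^ 3 ^ 3) \<Rightarrow> (3 \<Rightarrow> real ^ 3 \<Rightarrow> real ^ 3 ^ 3) \<Rightarrow> real ^ 3 ^ 3 \<Rightarrow> field_operator" where
  "hydro_operator g b c U \<psi> x =
     (\<chi> i. \<Sum>j\<in>UNIV.
        g (U x) $ i $ j * deriv (\<lambda>y. \<psi> y $ j) x
        + (\<Sum>k\<in>UNIV. b k (U x) $ i $ j * deriv (\<lambda>y. U y $ k) x) * \<psi> x $ j
        + c $ i $ j * dx_inv (\<lambda>y. \<psi> y $ j) x)"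


section \<open>Functionals and Casimirs\<close>

text \<open>
  A functional is represented by its density \<open>h(x, u, v, w)\<close>, which does not depend on
  derivatives. Its variational derivative therefore consists of the partial derivatives of the
  density.
\<close>

type_synonym density = "real \<Rightarrow> real ^ 3 \<Rightarrow> real"

definition var_deriv :: "density \<Rightarrow> field \<Rightarrow> field" where
  "var_deriv h U x = (\<chi> j. deriv (\<lambda>s. h x (U x + s *\<^sub>R axis j 1)) 0)"

definition casimir :: "field set \<Rightarrow> field_operator \<Rightarrow> density \<Rightarrow> bool" where
  "casimir S P h \<longleftrightarrow> (\<forall>U\<in>S. \<forall>x. P U (var_deriv h U) x = 0)"


section \<open>Hamiltonian operators and bi-Hamiltonian pairs\<close>

definition smooth_field :: "field \<Rightarrow> bool" where
  "smooth_field U \<longleftrightarrow>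
     (\<forall>i n x. (deriv ^^ n) (\<lambda>y. U y $ i) differentiable (at x))"

definition test_covector :: "field \<Rightarrow> bool" where
  "test_covector \<psi> \<longleftrightarrow> smooth_field \<psi> \<and> bounded {x. \<psi> x \<noteq> 0}"

text \<open>The derivative of \<open>P U \<psi>\<close> with respect to \<open>U\<close> in the direction \<open>X\<close>.\<close>

definition operator_deriv :: "field_operator \<Rightarrow> field \<Rightarrow> field \<Rightarrow> field \<Rightarrow> field" where
  "operator_deriv P U X \<psi> x =
     vector_derivative (\<lambda>\<epsilon>. P (\<lambda>y. U y + \<epsilon> *\<^sub>R X y) \<psi> x) (at 0)"

text \<open>
  An operator is Hamiltonian if it is skew-adjoint and its Schouten bracket with itself vanishes;
  this is the skew symmetry and the Jacobi identity of
  \<open>{F, G} = \<integral> (\<delta>F/\<delta>u\<^sup>i) P\<^sup>i\<^sup>j (\<delta>G/\<delta>u\<^sup>j) dx\<close>. Both identities are evaluated on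
  compactly supported covector fields, so that no boundary terms arise.
\<close>

definition hamiltonian_operator :: "field set \<Rightarrow> field_operator \<Rightarrow> bool" where
  "hamiltonian_operator S P \<longleftrightarrow>
     (\<forall>U\<in>S. \<forall>\<phi> \<psi>. test_covector \<phi> \<longrightarrow> test_covector \<psi> \<longrightarrow>
        ((\<lambda>x. \<phi> x \<bullet> P U \<psi> x + \<psi> x \<bullet> P U \<phi> x) has_integral 0) UNIV) \<and>
     (\<forall>U\<in>S. \<forall>\<phi> \<psi> \<eta>. test_covector \<phi> \<longrightarrow> test_covector \<psi> \<longrightarrow> test_covector \<eta> \<longrightarrow>
        ((\<lambda>x. \<phi> x \<bullet> operator_deriv P U (P U \<psi>) \<eta> x
             + \<psi> x \<bullet> operator_deriv P U (P U \<eta>) \<phi> x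
             + \<eta> x \<bullet> operator_deriv P U (P U \<phi>) \<psi> x) has_integral 0) UNIV)"

definition bi_hamiltonian_pair :: "field set \<Rightarrow> field_operator \<Rightarrow> field_operator \<Rightarrow> bool" where
  "bi_hamiltonian_pair S A B \<longleftrightarrow>
     hamiltonian_operator S A \<and> hamiltonian_operator S B \<and>
     (\<forall>c::real. hamiltonian_operator S (\<lambda>U \<psi> x. B U \<psi> x + c *\<^sub>R A U \<psi> x))"


section \<open>The pair, the functionals and the system\<close>

definition phase_space :: "field set" where
  "phase_space = {U. smooth_field U \<and> (\<forall>x. U x $ 3 \<noteq> 0)}"

definition A_op :: field_operator where
  "A_op = hydro_operator
     (\<lambda>_. vector [vector [0, 0, 1],
                  vector [0, 1, 0],
                  vector [1, 0, 0]])
     (\<lambda>_ _. 0)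
     0"

definition B_metric :: "real ^ 3 \<Rightarrow> real ^ 3 ^ 3" where
  "B_metric y = (let v = y $ 2; w = y $ 3 in
     vector [vector [v^3 / w^2, - (3 * v^2 / (2 * w)), - v + 1],
             vector [- (3 * v^2 / (2 * w)), 2 * v + 1, w],
             vector [- v + 1, w, 0]])"

definition B_coeff_u :: "real ^ 3 ^ 3" where
  "B_coeff_u =
     vector [vector [0, 1, 0],
             vector [-1, 0, 0],
             vector [0, 0, 0]]"

definition B_coeff_v :: "real ^ 3 \<Rightarrow> real ^ 3 ^ 3" where
  "B_coeff_v y = (let v = y $ 2; w = y $ 3 in
     vector [vector [3 * v^2 / (2 * w^2), 0, 0],
             vector [- (3 * v / w), 1, 0],
             vector [-1, 0, 0]])"

definition B_coeff_w :: "real ^ 3 \<Rightarrow> real ^ 3 ^ 3" where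
  "B_coeff_w y = (let v = y $ 2; w = y $ 3 in
     vector [vector [- (v^3 / w^3), 0, 0],
             vector [3 * v^2 / (2 * w^2), 0, 0],
             vector [0, 1, 0]])"

definition B_op :: field_operator where
  "B_op = hydro_operator
     B_metric
     (\<lambda>k y. if k = 1 then B_coeff_u else if k = 2 then B_coeff_v y else B_coeff_w y)
     (vector [vector [1, 0, 0],
              vector [0, 0, 0],
              vector [0, 0, 0]])"

definition u_density :: density where
  "u_density x y = y $ 1"

definition L_density :: density where
  "L_density x y = - u_density x y"

definition F_density :: density where
  "F_density x y = (let u = y $ 1; v = y $ 2; w = y $ 3 in
     u * v + v^3 / (2 * w) - x^2 / 2 * w)"

text \<open>Functions of \<open>(t, x)\<close> take \<open>t\<close> first, so \<open>v t\<close> is the profile at time \<open>t\<close>.\<close>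

definition state :: "(real \<Rightarrow> real \<Rightarrow> real) \<Rightarrow> (real \<Rightarrow> real \<Rightarrow> real) \<Rightarrow> (real \<Rightarrow> real \<Rightarrow> real) \<Rightarrow> real \<Rightarrow> field" where
  "state u v w t x = vector [u t x, v t x, w t x]"

definition solves_system ::
  "(real \<times> real) set \<Rightarrow> (real \<Rightarrow> real \<Rightarrow> real) \<Rightarrow> (real \<Rightarrow> real \<Rightarrow> real) \<Rightarrow> (real \<Rightarrow> real \<Rightarrow> real) \<Rightarrow> bool"
where
  "solves_system D u v w \<longleftrightarrow> (\<forall>(t, x)\<in>D.
     ((\<lambda>s. u s x) has_real_derivative
        - (3 * (v t x)^2 / (2 * (w t x)^2)) * deriv (v t) x
        + (v t x)^3 / (w t x)^3 * deriv (w t) x - x) (at t) \<and>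
     ((\<lambda>s. v s x) has_real_derivative
        deriv (u t) x + 3 * v t x / w t x * deriv (v t) x
        - 3 * (v t x)^2 / (2 * (w t x)^2) * deriv (w t) x) (at t) \<and>
     ((\<lambda>s. w s x) has_real_derivative deriv (v t) x) (at t))"

definition evolves_by :: "(real \<times> real) set \<Rightarrow> (field \<Rightarrow> field) \<Rightarrow> (real \<Rightarrow> field) \<Rightarrow> bool" where
  "evolves_by D K q \<longleftrightarrow>
     (\<forall>(t, x)\<in>D. ((\<lambda>s. q s x) has_vector_derivative K (q t) x) (at t))"

end

theory Submission
  imports Defs
begin

text \<open>
  The coefficients of \<open>B\<close> are derivatives: \<open>b\<^sup>i\<^sup>j\<^sub>k = \<partial>\<^sub>k f\<^sup>i\<^sup>j\<close> for some matrix \<open>f\<close>, and the metric of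
  \<open>B + cA\<close> is \<open>f\<close> plus its transpose plus a constant. Skew-adjointness follows at once, since the nonlocal
  terms \<open>\<phi>\<^sub>1 \<partial>\<^sup>-\<^sup>1\<psi>\<^sub>1 + \<psi>\<^sub>1 \<partial>\<^sup>-\<^sup>1\<phi>\<^sub>1\<close> form the derivative of a product that takes equal values
  near \<open>-\<infinity>\<close> and \<open>+\<infinity>\<close>. For the Jacobi identity, let \<open>Y\<close> be the local part of \<open>(B + cA)\<psi>\<close>. Then
  \<open>\<phi> \<bullet> P'[P\<psi>]\<eta>\<close>, where \<open>P = B + cA\<close>, is the total derivative of \<open>b(Y; \<phi>, \<eta>) = b\<^sup>i\<^sup>j\<^sub>k Y\<^sup>k \<phi>\<^sub>i \<eta>\<^sub>j\<close>
  plus \<open>b(Y; \<eta>\<^sub>x, \<phi>) - b(Y; \<phi>\<^sub>x, \<eta>)\<close> plus \<open>\<psi>\<^sub>1(\<phi>\<^sub>1\<eta>\<^sub>2 - \<phi>\<^sub>2\<eta>\<^sub>1)\<close>, the last term being all that the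
  nonlocal part of \<open>P\<psi>\<close> contributes. Both extra terms vanish pointwise after cyclic summation.
\<close>

section \<open>Componentwise derivatives, and the pencil written through multilinear forms\<close>

lemma has_vector_derivative_cart_iff:
  fixes f :: "real \<Rightarrow> real ^ 'n"
  shows "(f has_vector_derivative D) (at x) \<longleftrightarrow>
    (\<forall>i. ((\<lambda>y. f y $ i) has_real_derivative D $ i) (at x))"
  unfolding has_vector_derivative_def has_real_derivative_iff_has_vector_derivative
    has_derivative_componentwise_within[of f]
  by (auto simp: Basis_vec_def inner_axis)

definition dfield :: "field \<Rightarrow> field" where
  "dfield U x = (\<chi> k. deriv (\<lambda>y. U y $ k) x)"

text \<open>Written out in components, with \<open>p = v / w\<close>, this is \<open>b\<^sup>i\<^sup>j\<^sub>k z\<^sup>k a\<^sub>i b\<^sub>j\<close>.\<close>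

definition conn :: "real ^ 3 \<Rightarrow> real ^ 3 \<Rightarrow> real ^ 3 \<Rightarrow> real ^ 3 \<Rightarrow> real" where
  "conn y z a b = (let p = y$2 / y$3 in
     (3/2 * p^2 * z$2 - p^3 * z$3) * (a$1 * b$1) + z$1 * (a$1 * b$2)
     + (- z$1 - 3 * p * z$2 + 3/2 * p^2 * z$3) * (a$2 * b$1) + z$2 * (a$2 * b$2)
     - z$2 * (a$3 * b$1) + z$3 * (a$3 * b$2))"

text \<open>
  The contraction \<open>b\<^sup>i\<^sup>j\<^sub>k\<^sub>,\<^sub>l z\<^sup>l z'\<^sup>k a\<^sub>i b\<^sub>j\<close>, where \<open>q\<close> is the derivative of \<open>p\<close> in the direction \<open>z\<close>.
\<close>

definition hess :: "real ^ 3 \<Rightarrow> real ^ 3 \<Rightarrow> real ^ 3 \<Rightarrow> real ^ 3 \<Rightarrow> real ^ 3 \<Rightarrow> real" where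
  "hess y z z' a b = (let p = y$2 / y$3; q = (z$2 - p * z$3) / y$3 in
     3 * q * (z'$2 - p * z'$3) * (p * (a$1 * b$1) - a$2 * b$1))"

text \<open>The metric of \<open>B + cA\<close> as a symmetric form. Writing \<open>v\<close> as
  \<open>p * w\<close> makes its entries polynomial in \<open>p\<close>, \<open>w\<close> and
  \<open>c\<close>.\<close>

definition pencil_metric :: "real \<Rightarrow> real ^ 3 \<Rightarrow> real ^ 3 \<Rightarrow> real ^ 3 \<Rightarrow> real" where
  "pencil_metric c y a b = (let p = y$2 / y$3; w = y$3 in
     p^3 * w * (a$1 * b$1) - 3/2 * p^2 * w * (a$1 * b$2 + a$2 * b$1)
     + (1 + c - p * w) * (a$1 * b$3 + a$3 * b$1) + (1 + c + 2 * p * w) * (a$2 * b$2)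
     + w * (a$2 * b$3 + a$3 * b$2))"

definition local_part :: "real \<Rightarrow> real ^ 3 \<Rightarrow> real ^ 3 \<Rightarrow> real ^ 3 \<Rightarrow> real ^ 3 \<Rightarrow> real ^ 3" where
  "local_part c y y' a a' = (\<chi> i. pencil_metric c y (axis i 1) a' + conn y y' (axis i 1) a)"

definition pencil :: "real \<Rightarrow> field_operator" where
  "pencil c U \<psi> x = B_op U \<psi> x + c *\<^sub>R A_op U \<psi> x"

lemma axis_3 [simp]:
  "axis (1::3) (1::real) $ 1 = 1" "axis (1::3) (1::real) $ 2 = 0" "axis (1::3) (1::real) $ 3 = 0"
  "axis (2::3) (1::real) $ 1 = 0" "axis (2::3) (1::real) $ 2 = 1" "axis (2::3) (1::real) $ 3 = 0"
  "axis (3::3) (1::real) $ 1 = 0" "axis (3::3) (1::real) $ 2 = 0" "axis (3::3) (1::real) $ 3 = 1"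
  by (simp_all add: axis_def)

lemma inner_3: "(a :: real ^ 3) \<bullet> b = a$1 * b$1 + a$2 * b$2 + a$3 * b$3"
  by (simp add: inner_vec_def sum_3)

text \<open>A nonzero \<open>w\<close> permits \<open>v = p * w\<close>. Skew-adjointness and the
  Jacobi identity use the operator only through this splitting, whose nonlocal term does not depend
  on the field.\<close>

lemma pencil_eq:
  assumes "U x $ 3 \<noteq> 0"
  shows "pencil c U \<psi> x = local_part c (U x) (dfield U x) (\<psi> x) (dfield \<psi> x)
           + dx_inv (\<lambda>y. \<psi> y $ 1) x *\<^sub>R axis 1 1"
  using assms
  by (simp add: vec_eq_iff forall_3 pencil_def A_op_def B_op_def hydro_operator_def sum_3
      B_metric_def B_coeff_u_def B_coeff_v_def B_coeff_w_def local_part_def pencil_metric_def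
      conn_def dfield_def Let_def field_simps power2_eq_square power3_eq_cube)

lemma inner_local_part:
  "a \<bullet> local_part c y y' b b' = pencil_metric c y a b' + conn y y' a b"
  by (simp add: inner_3 local_part_def pencil_metric_def conn_def Let_def algebra_simps)

text \<open>
  This identity encodes that the metric of the pencil is flat with torsion-free connection.
\<close>

lemma conn_local_part_cyclic:
  "conn y (local_part c y y' s s') h' f - conn y (local_part c y y' s s') f' h
   + (conn y (local_part c y y' h h') f' s - conn y (local_part c y y' h h') s' f)
   + (conn y (local_part c y y' f f') s' h - conn y (local_part c y y' f f') h' s) = 0"
proof -
  \<comment> \<open>In the variables \<open>p\<close> and \<open>w\<close> the identity is
    polynomial, so that \<open>algebra\<close> can decide it.\<close>
  define w where "w = y$3"
  define p where "p = y$2 / w"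
  have pw: "y$3 = w" "y$2 / w = p"
    by (simp_all add: p_def w_def)
  show ?thesis
    by (simp only: local_part_def pencil_metric_def conn_def Let_def pw vec_lambda_beta axis_3
        mult_1_left mult_1_right mult_zero_left mult_zero_right add_0_left add_0_right diff_0_right diff_0)
      algebra
qed

text \<open>Since \<open>b\<close> is the gradient of the matrix \<open>f\<close>, its derivative is
  symmetric in the two directions. Explicitly, both sides contain the product of
  \<open>z$2 - p * z$3\<close> and \<open>z'$2 - p * z'$3\<close>.\<close>

lemma hess_commute: "hess y z z' a b = hess y z' z a b"
  unfolding hess_def Let_def
  by (simp only: times_divide_eq_right times_divide_eq_left mult_ac)

section \<open>Product rules for the forms along curves\<close>

lemma has_vector_derivative_nth:
  fixes f :: "real \<Rightarrow> real ^ 'n"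
  assumes "(f has_vector_derivative D) (at x)"
  shows "((\<lambda>y. f y $ i) has_real_derivative D $ i) (at x)"
  using assms by (simp add: has_vector_derivative_cart_iff)

lemma conn_has_derivative:
  assumes "(Y has_vector_derivative y') (at t)" "(Z has_vector_derivative z') (at t)"
    and "(A has_vector_derivative a') (at t)" "(B has_vector_derivative b') (at t)"
    and "Y t $ 3 \<noteq> 0"
  shows "((\<lambda>s. conn (Y s) (Z s) (A s) (B s)) has_real_derivative
    hess (Y t) y' (Z t) (A t) (B t) + conn (Y t) z' (A t) (B t)
    + conn (Y t) (Z t) a' (B t) + conn (Y t) (Z t) (A t) b') (at t)"
proof -
  note d = assms(1-4)[THEN has_vector_derivative_nth]
  define P where "P s = Y s $ 2 / Y s $ 3" for s
  note P = P_def[symmetric]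
  define q where "q = (y'$2 - P t * y'$3) / Y t $ 3"
  note q = q_def[symmetric]
  have P': "(P has_real_derivative q) (at t)"
    unfolding P_def[abs_def] q_def
    using assms(5) by (auto intro!: derivative_eq_intros d simp: field_simps)
  have "((\<lambda>s. P s ^ 2) has_real_derivative 2 * P t * q) (at t)"
    "((\<lambda>s. P s ^ 3) has_real_derivative 3 * P t ^ 2 * q) (at t)"
    by (auto intro!: derivative_eq_intros P')
  note d' = d P' this
  show ?thesis
    unfolding conn_def hess_def Let_def P q
    by (rule derivative_eq_intros d' refl)+ algebra
qed

text \<open>The two \<open>conn\<close> terms express compatibility of metric and connection: the
  metric is \<open>f\<close> plus its transpose plus a constant, so its derivative is
  \<open>b\<close> plus its transpose.\<close>

lemma pencil_metric_has_derivative: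
  assumes "(Y has_vector_derivative y') (at t)"
    and "(A has_vector_derivative a') (at t)" "(B has_vector_derivative b') (at t)"
    and "Y t $ 3 \<noteq> 0"
  shows "((\<lambda>s. pencil_metric c (Y s) (A s) (B s)) has_real_derivative
    conn (Y t) y' (A t) (B t) + conn (Y t) y' (B t) (A t)
    + pencil_metric c (Y t) a' (B t) + pencil_metric c (Y t) (A t) b') (at t)"
proof -
  note d = assms(1-3)[THEN has_vector_derivative_nth]
  define P where "P s = Y s $ 2 / Y s $ 3" for s
  note P = P_def[symmetric]
  define q where "q = (y'$2 - P t * y'$3) / Y t $ 3"
  \<comment> \<open>Differentiating \<open>v = p * w\<close> expresses \<open>y'$2\<close> through
    \<open>q\<close>, so that the goal left to \<open>algebra\<close> is polynomial.\<close>
  have y2: "y'$2 = q * Y t $ 3 + P t * y'$3"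
    using assms(4) by (simp add: q_def)
  have P': "(P has_real_derivative q) (at t)"
    unfolding P_def[abs_def] q_def
    using assms(4) by (auto intro!: derivative_eq_intros d simp: field_simps)
  have "((\<lambda>s. P s ^ 2) has_real_derivative 2 * P t * q) (at t)"
    "((\<lambda>s. P s ^ 3) has_real_derivative 3 * P t ^ 2 * q) (at t)"
    by (auto intro!: derivative_eq_intros P')
  note d' = d P' this
  show ?thesis
    unfolding conn_def pencil_metric_def Let_def P y2
    by (rule derivative_eq_intros d' refl)+ algebra
qed

lemma conn_add: "conn y (z + z') a b = conn y z a b + conn y z' a b"
  by (simp add: conn_def Let_def add_divide_distrib algebra_simps)

text \<open>The nonlocal part of the pencil points in the direction of \<open>u\<close>, and the
  matrix that multiplies the derivative of \<open>u\<close> is constant and antisymmetric.\<close>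

lemma conn_scaleR_axis: "conn y (r *\<^sub>R axis 1 1) a b = r * (a$1 * b$2 - a$2 * b$1)"
  by (simp add: conn_def Let_def algebra_simps)

section \<open>Total derivatives, and the inverse derivative under compact support\<close>

text \<open>All integral identities below are proved in this form. A nonzero \<open>C\<close> occurs
  for skew-adjointness, where the product of two inverse derivatives does not vanish near
  infinity.\<close>

lemma has_integral_deriv_const_outside:
  fixes H h :: "real \<Rightarrow> real"
  assumes H: "\<And>x. (H has_real_derivative h x) (at x)"
    and const: "\<And>x. R \<le> \<bar>x\<bar> \<Longrightarrow> H x = C"
  shows "(h has_integral 0) UNIV"
proof -
  define S where "S = \<bar>R\<bar> + 1"
  have "(h has_integral H S - H (-S)) {-S..S}"
    using H by (intro fundamental_theorem_of_calculus)
      (auto simp: S_def has_real_derivative_iff_has_vector_derivative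
        intro: has_vector_derivative_at_within)
  moreover have "H S = C" "H (-S) = C"
    by (auto intro!: const simp: S_def)
  \<comment> \<open>Outside the interval \<open>H\<close> is locally constant, so its derivative
    vanishes there.\<close>
  moreover have "h x = 0" if "x \<notin> {-S..S}" for x
  proof -
    have "\<forall>\<^sub>F y in nhds x. y \<in> - {-S..S}"
      by (rule eventually_nhds_in_open) (use that in \<open>auto simp: open_Compl\<close>)
    then have "\<forall>\<^sub>F y in nhds x. H y = C"
      by eventually_elim (auto intro!: const simp: S_def)
    then have "((\<lambda>_. C) has_real_derivative h x) (at x)"
      using H[of x] by (simp only: DERIV_cong_ev[OF refl _ refl])
    then show ?thesis
      using DERIV_const by (rule DERIV_unique)
  qed
  ultimately show ?thesis
    using has_integral_on_superset[of h 0 "{-S..S}" UNIV] by auto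
qed

text \<open>The limit is taken of an eventually constant function; this covers both compactly
  supported and constant arguments.\<close>

lemma dx_inv_eqI:
  assumes "\<And>R. r \<le> R \<Longrightarrow> (integral {-R..x} f - integral {x..R} f) / 2 = l"
  shows "dx_inv f x = l"
  unfolding dx_inv_def
  by (rule tendsto_Lim, simp, rule tendsto_eventually, rule eventually_at_top_linorderI[of r])
    (use assms in auto)

text \<open>The symmetric cutoff selects the antiderivative with opposite values at the two ends,
  \<open>C\<close> being half of the total integral. Products of two such antiderivatives therefore
  take equal values at both ends.\<close>

lemma dx_inv_compact_support:
  assumes cont: "continuous_on UNIV f"
    and supp: "\<And>x. R \<le> \<bar>x\<bar> \<Longrightarrow> f x = 0"
  obtains C where "\<And>x. (dx_inv f has_real_derivative f x) (at x)"
    "\<And>x. \<bar>R\<bar> \<le> x \<Longrightarrow> dx_inv f x = C" "\<And>x. x \<le> - \<bar>R\<bar> \<Longrightarrow> dx_inv f x = - C"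
proof -
  define S where "S = \<bar>R\<bar>"
  \<comment> \<open>The antiderivative theorem is stated for intervals with extended real endpoints;
    here the interval is the whole line.\<close>
  have "\<exists>F. \<forall>x::real. -\<infinity> < ereal x \<longrightarrow> ereal x < \<infinity> \<longrightarrow> (F has_vector_derivative f x) (at x)"
    using cont by (intro einterval_antiderivative)
      (simp_all add: continuous_on_eq_continuous_at[OF open_UNIV])
  then obtain F where F: "\<And>x. (F has_vector_derivative f x) (at x)"
    by auto
  have int: "integral {a..b} f = F b - F a" if "a \<le> b" for a b
    by (intro integral_unique fundamental_theorem_of_calculus that)
      (rule has_vector_derivative_at_within[OF F])
  have hi: "F x = F S" if "S \<le> x" for x
  proof -
    have "integral {S..x} f = 0"
      by (intro integral_unique has_integral_is_0) (use supp in \<open>auto simp: S_def\<close>)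
    then show ?thesis using int that by simp
  qed
  have lo: "F x = F (-S)" if "x \<le> -S" for x
  proof -
    have "integral {x..-S} f = 0"
      by (intro integral_unique has_integral_is_0) (use supp in \<open>auto simp: S_def\<close>)
    then show ?thesis using int that by simp
  qed
  have eq: "dx_inv f x = F x - (F S + F (-S)) / 2" for x
  \<comment> \<open>From this threshold on, the cutoff encloses both \<open>x\<close> and the
    support.\<close>
  proof (rule dx_inv_eqI[of "max S \<bar>x\<bar>"])
    fix Q assume "max S \<bar>x\<bar> \<le> Q"
    then have "-Q \<le> x" "x \<le> Q" "S \<le> Q" "-Q \<le> -S"
      by linarith+
    then show "(integral {-Q..x} f - integral {x..Q} f) / 2 = F x - (F S + F (-S)) / 2"
      by (simp add: int hi[of Q] lo[of "-Q"] field_simps)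
  qed
  show ?thesis
  proof (rule that[of "(F S - F (-S)) / 2"])
    show "(dx_inv f has_real_derivative f x) (at x)" for x
      unfolding eq[abs_def]
      using F[of x] by (auto intro!: derivative_eq_intros simp: has_real_derivative_iff_has_vector_derivative)
    show "dx_inv f x = (F S - F (-S)) / 2" if "\<bar>R\<bar> \<le> x" for x
      using hi[of x] that by (simp add: eq field_simps flip: S_def)
    show "dx_inv f x = - ((F S - F (-S)) / 2)" if "x \<le> - \<bar>R\<bar>" for x
      using lo[of x] that by (simp add: eq field_simps flip: S_def)
  qed
qed

section \<open>Smooth fields and compactly supported covectors\<close>

lemma dfield_eqI: "(U has_vector_derivative D) (at x) \<Longrightarrow> dfield U x = D"
  by (simp add: dfield_def vec_eq_iff has_vector_derivative_cart_iff DERIV_imp_deriv)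

lemma smooth_field_has_derivative:
  assumes "smooth_field U"
  shows "(U has_vector_derivative dfield U x) (at x)"
proof -
  have "(deriv ^^ 0) (\<lambda>y. U y $ i) differentiable (at x)" for i
    using assms unfolding smooth_field_def by blast
  then show ?thesis
    by (simp add: has_vector_derivative_cart_iff dfield_def DERIV_deriv_iff_real_differentiable)
qed

lemma smooth_field_dfield:
  assumes "smooth_field U"
  shows "smooth_field (dfield U)"
proof -
  have "(deriv ^^ n) (\<lambda>y. dfield U y $ i) = (deriv ^^ Suc n) (\<lambda>y. U y $ i)" for n i
    by (simp only: dfield_def vec_lambda_beta funpow_Suc_right o_def)
  then show ?thesis
    using assms unfolding smooth_field_def by metis
qed

lemma test_covector_support:
  assumes "test_covector \<psi>"
  obtains R where "\<And>x. R \<le> \<bar>x\<bar> \<Longrightarrow> \<psi> x = 0"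
proof -
  obtain B where "\<And>x. \<psi> x \<noteq> 0 \<Longrightarrow> \<bar>x\<bar> \<le> B"
    using assms by (auto simp: test_covector_def bounded_iff)
  \<comment> \<open>The covector may still be nonzero where the absolute value of \<open>x\<close>
    equals \<open>B\<close>, hence the added 1.\<close>
  then have "\<psi> x = 0" if "B + 1 \<le> \<bar>x\<bar>" for x
    using that by fastforce
  then show ?thesis by (rule that)
qed

lemma test_covector_dx_inv:
  assumes "test_covector \<psi>"
  obtains C R where "\<And>x. (dx_inv (\<lambda>y. \<psi> y $ i) has_real_derivative \<psi> x $ i) (at x)"
    "\<And>x. R \<le> x \<Longrightarrow> dx_inv (\<lambda>y. \<psi> y $ i) x = C" "\<And>x. x \<le> - R \<Longrightarrow> dx_inv (\<lambda>y. \<psi> y $ i) x = - C"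
proof -
  obtain R where R: "\<And>x. R \<le> \<bar>x\<bar> \<Longrightarrow> \<psi> x = 0"
    using assms by (rule test_covector_support) blast
  have "continuous_on UNIV (\<lambda>y. \<psi> y $ i)"
    using assms unfolding test_covector_def
    by (auto intro!: continuous_at_imp_continuous_on DERIV_isCont
        has_vector_derivative_nth[OF smooth_field_has_derivative])
  then obtain C where "\<And>x. (dx_inv (\<lambda>y. \<psi> y $ i) has_real_derivative \<psi> x $ i) (at x)"
    "\<And>x. \<bar>R\<bar> \<le> x \<Longrightarrow> dx_inv (\<lambda>y. \<psi> y $ i) x = C"
    "\<And>x. x \<le> - \<bar>R\<bar> \<Longrightarrow> dx_inv (\<lambda>y. \<psi> y $ i) x = - C"
    by (rule dx_inv_compact_support[of _ R]) (auto simp: R)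
  then show ?thesis
    by (rule that)
qed

section \<open>Linearisation of the pencil in the field\<close>

lemma conn_zero [simp]: "conn y z 0 b = 0" "conn y z a 0 = 0"
  by (simp_all add: conn_def Let_def)

lemma pencil_metric_zero [simp]: "pencil_metric c y 0 b = 0" "pencil_metric c y a 0 = 0"
  by (simp_all add: pencil_metric_def Let_def)

lemma pencil_metric_commute: "pencil_metric c y a b = pencil_metric c y b a"
  by (simp add: pencil_metric_def Let_def algebra_simps)

text \<open>The coefficients do not depend on \<open>u\<close>, so the nonlocal part of a direction
  is invisible to \<open>hess\<close>.\<close>

lemma hess_add_scaleR_axis: "hess y (z + r *\<^sub>R axis 1 1) z' a b = hess y z z' a b"
  by (simp add: hess_def Let_def)

text \<open>Existence suffices: after pairing with a covector the value comes from the scalar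
  product rules, and in the Jacobi identity it stays inside a total derivative.\<close>

lemma local_part_has_derivative:
  assumes "(Y has_vector_derivative y) (at t)" "(Y' has_vector_derivative y') (at t)"
    and "(A has_vector_derivative a) (at t)" "(A' has_vector_derivative a') (at t)"
    and "Y t $ 3 \<noteq> 0"
  obtains D where "((\<lambda>s. local_part c (Y s) (Y' s) (A s) (A' s)) has_vector_derivative D) (at t)"
proof -
  have "\<exists>d. ((\<lambda>s. local_part c (Y s) (Y' s) (A s) (A' s) $ i) has_real_derivative d) (at t)" for i
    unfolding local_part_def vec_lambda_beta
    by (rule exI, rule DERIV_add,
        rule pencil_metric_has_derivative[OF assms(1) has_vector_derivative_const assms(4,5)],
        rule conn_has_derivative[OF assms(1,2) has_vector_derivative_const assms(3,5)])
  then have "\<forall>i. \<exists>d. ((\<lambda>s. local_part c (Y s) (Y' s) (A s) (A' s) $ i) has_real_derivative d) (at t)" ..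
  then have "\<exists>d. \<forall>i. ((\<lambda>s. local_part c (Y s) (Y' s) (A s) (A' s) $ i) has_real_derivative d i) (at t)"
    by (rule choice)
  then obtain d where
    "\<forall>i. ((\<lambda>s. local_part c (Y s) (Y' s) (A s) (A' s) $ i) has_real_derivative d i) (at t)" ..
  then show ?thesis
    by (intro that[of "\<chi> i. d i"]) (simp add: has_vector_derivative_cart_iff)
qed

text \<open>The nonlocal term is constant in \<epsilon> and drops out. The first two terms
  differentiate the metric, the last two the connection.\<close>

lemma inner_operator_deriv_pencil:
  assumes U: "(U has_vector_derivative dfield U x) (at x)" "U x $ 3 \<noteq> 0"
    and X: "(X has_vector_derivative X') (at x)"
  shows "a \<bullet> operator_deriv (pencil c) U X \<eta> x =
    conn (U x) (X x) a (dfield \<eta> x) + conn (U x) (X x) (dfield \<eta> x) a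
    + hess (U x) (X x) (dfield U x) a (\<eta> x) + conn (U x) X' a (\<eta> x)"
proof -
  define Y where "Y \<epsilon> = U x + \<epsilon> *\<^sub>R X x" for \<epsilon>
  define Y' where "Y' \<epsilon> = dfield U x + \<epsilon> *\<^sub>R X'" for \<epsilon>
  define P where "P \<epsilon> = local_part c (Y \<epsilon>) (Y' \<epsilon>) (\<eta> x) (dfield \<eta> x)" for \<epsilon>
  define d where "d = dx_inv (\<lambda>y. \<eta> y $ 1) x *\<^sub>R axis (1::3) (1::real)"
  have Y: "(Y has_vector_derivative X x) (at 0)" "(Y' has_vector_derivative X') (at 0)"
    unfolding Y_def[abs_def] Y'_def[abs_def] by (auto intro!: derivative_eq_intros)
  have Y0: "Y 0 = U x" "Y' 0 = dfield U x" "Y 0 $ 3 \<noteq> 0"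
    using U by (simp_all add: Y_def Y'_def)
  obtain D where D: "(P has_vector_derivative D) (at 0)"
    unfolding P_def[abs_def]
    using local_part_has_derivative[OF Y has_vector_derivative_const has_vector_derivative_const Y0(3)]
    by blast
  have dfield_Y: "dfield (\<lambda>y. U y + \<epsilon> *\<^sub>R X y) x = Y' \<epsilon>" for \<epsilon>
    unfolding Y'_def by (intro dfield_eqI) (auto intro!: derivative_eq_intros U X)
  \<comment> \<open>The formula for \<open>pencil\<close> needs a nonzero third component, which
    persists for small \<epsilon>; agreement near 0 determines the derivative.\<close>
  have "\<forall>\<^sub>F \<epsilon> in at 0. Y \<epsilon> $ 3 \<noteq> 0"
    using DERIV_isCont[OF has_vector_derivative_nth[OF Y(1)]] Y0(3)
    unfolding isCont_def by (rule tendsto_imp_eventually_ne)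
  then have "\<forall>\<^sub>F \<epsilon> in nhds 0. Y \<epsilon> $ 3 \<noteq> 0"
    unfolding eventually_at_filter by eventually_elim (use Y0(3) in auto)
  then have "\<forall>\<^sub>F \<epsilon> in nhds 0. pencil c (\<lambda>y. U y + \<epsilon> *\<^sub>R X y) \<eta> x = P \<epsilon> + d"
    by eventually_elim (simp add: pencil_eq dfield_Y P_def d_def flip: Y_def)
  moreover have "((\<lambda>\<epsilon>. P \<epsilon> + d) has_vector_derivative D) (at 0)"
    using D by (auto intro!: derivative_eq_intros)
  ultimately have "operator_deriv (pencil c) U X \<eta> x = D"
    unfolding operator_deriv_def
    by (subst vector_derivative_cong_eq[where g = "\<lambda>\<epsilon>. P \<epsilon> + d"]) (auto simp: vector_derivative_at)
  \<comment> \<open>The value of \<open>D\<close> is not explicit; differentiating the pairing in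
    two ways identifies \<open>a \<bullet> D\<close>.\<close>
  moreover have "((\<lambda>\<epsilon>. a \<bullet> P \<epsilon>) has_vector_derivative a \<bullet> D) (at 0)"
    using D by (rule bounded_linear.has_vector_derivative[OF bounded_linear_inner_right])
  moreover have "((\<lambda>\<epsilon>. a \<bullet> P \<epsilon>) has_real_derivative
    conn (U x) (X x) a (dfield \<eta> x) + conn (U x) (X x) (dfield \<eta> x) a
    + hess (U x) (X x) (dfield U x) a (\<eta> x) + conn (U x) X' a (\<eta> x)) (at 0)"
    unfolding P_def inner_local_part
    by (rule DERIV_cong[OF DERIV_add[OF pencil_metric_has_derivative[OF Y(1)
        has_vector_derivative_const has_vector_derivative_const Y0(3)]
      conn_has_derivative[OF Y has_vector_derivative_const has_vector_derivative_const Y0(3)]]])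
      (simp add: Y0)
  ultimately show ?thesis
    by (metis has_real_derivative_iff_has_vector_derivative vector_derivative_unique_at)
qed

section \<open>Skew-adjointness and the Jacobi identity\<close>

lemma A_op_eq: "A_op U \<psi> x = vector [dfield \<psi> x $ 3, dfield \<psi> x $ 2, dfield \<psi> x $ 1]"
  by (simp add: A_op_def hydro_operator_def dfield_def vec_eq_iff forall_3 sum_3)

text \<open>\<open>A\<close> is not a member of the family \<open>B + cA\<close> and is treated
  separately. Its coefficients are constant, so the linearisation vanishes.\<close>

lemma hamiltonian_A_op: "hamiltonian_operator S A_op"
proof -
  have "operator_deriv A_op U X \<psi> x = 0" for U X \<psi> x
    by (simp add: operator_deriv_def A_op_eq)
  moreover have "((\<lambda>x. \<phi> x \<bullet> A_op U \<psi> x + \<psi> x \<bullet> A_op U \<phi> x) has_integral 0) UNIV"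
    if test: "test_covector \<phi>" "test_covector \<psi>" for U \<phi> \<psi>
  proof -
    obtain R where "\<And>x. R \<le> \<bar>x\<bar> \<Longrightarrow> \<phi> x = 0"
      using test(1) by (rule test_covector_support) blast
    note d = test[unfolded test_covector_def, THEN conjunct1,
        THEN smooth_field_has_derivative, THEN has_vector_derivative_nth]
    show ?thesis
    proof (rule has_integral_deriv_const_outside)
      show "((\<lambda>x. \<phi> x $ 1 * \<psi> x $ 3 + \<phi> x $ 2 * \<psi> x $ 2 + \<phi> x $ 3 * \<psi> x $ 1) has_real_derivative
        \<phi> x \<bullet> A_op U \<psi> x + \<psi> x \<bullet> A_op U \<phi> x) (at x)" for x
        by (rule derivative_eq_intros d refl)+ (simp add: A_op_eq inner_3 algebra_simps)
      show "\<phi> x $ 1 * \<psi> x $ 3 + \<phi> x $ 2 * \<psi> x $ 2 + \<phi> x $ 3 * \<psi> x $ 1 = 0" if "R \<le> \<bar>x\<bar>" for x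
        using \<open>\<And>x. R \<le> \<bar>x\<bar> \<Longrightarrow> \<phi> x = 0\<close> that by simp
    qed
  qed
  ultimately show ?thesis
    by (simp add: hamiltonian_operator_def)
qed

lemma pencil_skew_adjoint:
  assumes "U \<in> phase_space" "test_covector \<phi>" "test_covector \<psi>"
  shows "((\<lambda>x. \<phi> x \<bullet> pencil c U \<psi> x + \<psi> x \<bullet> pencil c U \<phi> x) has_integral 0) UNIV"
proof -
  have U: "(U has_vector_derivative dfield U x) (at x)" "U x $ 3 \<noteq> 0" for x
    using assms(1) by (auto simp: phase_space_def smooth_field_has_derivative)
  note d = assms(2,3)[unfolded test_covector_def, THEN conjunct1, THEN smooth_field_has_derivative]
  obtain R where R: "\<And>x. R \<le> \<bar>x\<bar> \<Longrightarrow> \<phi> x = 0"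
    using assms(2) by (rule test_covector_support) blast
  obtain C\<^sub>\<phi> R\<^sub>\<phi> where \<phi>: "\<And>x. (dx_inv (\<lambda>y. \<phi> y $ 1) has_real_derivative \<phi> x $ 1) (at x)"
    "\<And>x. R\<^sub>\<phi> \<le> x \<Longrightarrow> dx_inv (\<lambda>y. \<phi> y $ 1) x = C\<^sub>\<phi>"
    "\<And>x. x \<le> - R\<^sub>\<phi> \<Longrightarrow> dx_inv (\<lambda>y. \<phi> y $ 1) x = - C\<^sub>\<phi>"
    by (rule test_covector_dx_inv[OF assms(2)]) blast
  obtain C\<^sub>\<psi> R\<^sub>\<psi> where \<psi>: "\<And>x. (dx_inv (\<lambda>y. \<psi> y $ 1) has_real_derivative \<psi> x $ 1) (at x)"
    "\<And>x. R\<^sub>\<psi> \<le> x \<Longrightarrow> dx_inv (\<lambda>y. \<psi> y $ 1) x = C\<^sub>\<psi>"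
    "\<And>x. x \<le> - R\<^sub>\<psi> \<Longrightarrow> dx_inv (\<lambda>y. \<psi> y $ 1) x = - C\<^sub>\<psi>"
    by (rule test_covector_dx_inv[OF assms(3)]) blast
  define H where "H x = pencil_metric c (U x) (\<phi> x) (\<psi> x)
    + dx_inv (\<lambda>y. \<phi> y $ 1) x * dx_inv (\<lambda>y. \<psi> y $ 1) x" for x
  show ?thesis
  proof (rule has_integral_deriv_const_outside)
    show "(H has_real_derivative \<phi> x \<bullet> pencil c U \<psi> x + \<psi> x \<bullet> pencil c U \<phi> x) (at x)" for x
      unfolding H_def[abs_def]
      by (rule derivative_eq_intros pencil_metric_has_derivative U d \<phi>(1) \<psi>(1) refl)+
        (simp add: pencil_eq U inner_add_right inner_local_part inner_axis
          pencil_metric_commute[of c _ "dfield \<phi> x"] algebra_simps)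
    \<comment> \<open>At the left end both inverse derivatives change sign, which leaves their
      product unchanged.\<close>
    show "H x = C\<^sub>\<phi> * C\<^sub>\<psi>" if "max R (max R\<^sub>\<phi> R\<^sub>\<psi>) \<le> \<bar>x\<bar>" for x
    proof (cases "0 \<le> x")
      case True
      then show ?thesis
        using that R[of x] by (simp add: H_def \<phi>(2) \<psi>(2))
    next
      case False
      then have "R \<le> \<bar>x\<bar>" "x \<le> - R\<^sub>\<phi>" "x \<le> - R\<^sub>\<psi>"
        using that by linarith+
      then show ?thesis
        using R[of x] by (simp add: H_def \<phi>(3) \<psi>(3))
    qed
  qed
qed

lemma pencil_jacobi:
  assumes "U \<in> phase_space" "test_covector \<phi>" "test_covector \<psi>" "test_covector \<eta>"
  shows "((\<lambda>x. \<phi> x \<bullet> operator_deriv (pencil c) U (pencil c U \<psi>) \<eta> x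
     + \<psi> x \<bullet> operator_deriv (pencil c) U (pencil c U \<eta>) \<phi> x
     + \<eta> x \<bullet> operator_deriv (pencil c) U (pencil c U \<phi>) \<psi> x) has_integral 0) UNIV"
proof -
  have U: "(U has_vector_derivative dfield U x) (at x)"
    "(dfield U has_vector_derivative dfield (dfield U) x) (at x)" "U x $ 3 \<noteq> 0" for x
    using assms(1) by (auto simp: phase_space_def smooth_field_has_derivative smooth_field_dfield)
  define Y where "Y \<psi> x = local_part c (U x) (dfield U x) (\<psi> x) (dfield \<psi> x)" for \<psi> x
  define G where "G \<phi> \<psi> \<eta> x = hess (U x) (dfield U x) (Y \<psi> x) (\<phi> x) (\<eta> x)
    + conn (U x) (dfield (Y \<psi>) x) (\<phi> x) (\<eta> x) + conn (U x) (Y \<psi> x) (dfield \<phi> x) (\<eta> x)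
    + conn (U x) (Y \<psi> x) (\<phi> x) (dfield \<eta> x)" for \<phi> \<psi> \<eta> x
  have d: "(\<psi> has_vector_derivative dfield \<psi> x) (at x)" if "test_covector \<psi>" for \<psi> x
    using that by (simp add: test_covector_def smooth_field_has_derivative)
  have dY: "(Y \<psi> has_vector_derivative dfield (Y \<psi>) x) (at x)" if \<psi>: "test_covector \<psi>" for \<psi> x
  proof -
    have "(dfield \<psi> has_vector_derivative dfield (dfield \<psi>) x) (at x)"
      using \<psi> by (simp add: test_covector_def smooth_field_has_derivative smooth_field_dfield)
    then obtain D where "(Y \<psi> has_vector_derivative D) (at x)"
      unfolding Y_def[abs_def]
      using local_part_has_derivative[OF U(1,2) d[OF \<psi>] _ U(3)] by blast
    then show ?thesis
      by (simp add: dfield_eqI)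
  qed
  have G: "((\<lambda>x. conn (U x) (Y \<psi> x) (\<phi> x) (\<eta> x)) has_real_derivative G \<phi> \<psi> \<eta> x) (at x)"
    if "test_covector \<phi>" "test_covector \<psi>" "test_covector \<eta>" for \<phi> \<psi> \<eta> x
    unfolding G_def using that by (intro conn_has_derivative U d dY)
  \<comment> \<open>The inverse derivative itself cancels: it multiplies the antisymmetric form once
    at \<open>\<phi>\<close>, \<open>dfield \<eta>\<close> and once at the same arguments exchanged.
    Only its derivative, the first component of \<psi>, survives.\<close>
  have bracket: "\<phi> x \<bullet> operator_deriv (pencil c) U (pencil c U \<psi>) \<eta> x =
      G \<phi> \<psi> \<eta> x + (conn (U x) (Y \<psi> x) (dfield \<eta> x) (\<phi> x) - conn (U x) (Y \<psi> x) (dfield \<phi> x) (\<eta> x))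
      + \<psi> x $ 1 * (\<phi> x $ 1 * \<eta> x $ 2 - \<phi> x $ 2 * \<eta> x $ 1)"
    if test: "test_covector \<psi>" for \<phi> \<psi> \<eta> x
  proof -
    have \<psi>: "(dx_inv (\<lambda>y. \<psi> y $ 1) has_real_derivative \<psi> x $ 1) (at x)"
      by (rule test_covector_dx_inv[OF test]) blast
    have eq: "pencil c U \<psi> = (\<lambda>x. Y \<psi> x + dx_inv (\<lambda>y. \<psi> y $ 1) x *\<^sub>R axis 1 1)"
      by (simp add: fun_eq_iff pencil_eq U Y_def)
    have "(pencil c U \<psi> has_vector_derivative dfield (Y \<psi>) x + \<psi> x $ 1 *\<^sub>R axis 1 1) (at x)"
      unfolding eq using \<psi> dY[OF test] by (auto intro!: derivative_eq_intros)
    then show ?thesis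
      by (simp add: inner_operator_deriv_pencil[OF U(1,3)] eq G_def conn_add conn_scaleR_axis
          hess_add_scaleR_axis hess_commute[of "U x" "dfield U x"] algebra_simps)
  qed
  obtain R where R: "\<And>x. R \<le> \<bar>x\<bar> \<Longrightarrow> \<phi> x = 0"
    using assms(2) by (rule test_covector_support) blast
  obtain R' where R': "\<And>x. R' \<le> \<bar>x\<bar> \<Longrightarrow> \<psi> x = 0"
    using assms(3) by (rule test_covector_support) blast
  show ?thesis
  proof (rule has_integral_deriv_const_outside)
    fix x
    have "((\<lambda>x. conn (U x) (Y \<psi> x) (\<phi> x) (\<eta> x) + conn (U x) (Y \<eta> x) (\<psi> x) (\<phi> x)
        + conn (U x) (Y \<phi> x) (\<eta> x) (\<psi> x)) has_real_derivative
        G \<phi> \<psi> \<eta> x + G \<psi> \<eta> \<phi> x + G \<eta> \<phi> \<psi> x) (at x)"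
      by (intro DERIV_add G assms)
    then show "((\<lambda>x. conn (U x) (Y \<psi> x) (\<phi> x) (\<eta> x) + conn (U x) (Y \<eta> x) (\<psi> x) (\<phi> x)
        + conn (U x) (Y \<phi> x) (\<eta> x) (\<psi> x)) has_real_derivative
        \<phi> x \<bullet> operator_deriv (pencil c) U (pencil c U \<psi>) \<eta> x
        + \<psi> x \<bullet> operator_deriv (pencil c) U (pencil c U \<eta>) \<phi> x
        + \<eta> x \<bullet> operator_deriv (pencil c) U (pencil c U \<phi>) \<psi> x) (at x)"
      \<comment> \<open>This removes the cyclic sum of the local remainders; the cubic terms in the
        components of \<phi>, \<psi>, \<eta> cancel by expansion.\<close>
      using conn_local_part_cyclic[of "U x" c "dfield U x" "\<psi> x" "dfield \<psi> x" "dfield \<eta> x" "\<phi> x"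
          "dfield \<phi> x" "\<eta> x"]
      unfolding bracket[OF assms(2)] bracket[OF assms(3)] bracket[OF assms(4)]
      by (elim DERIV_cong) (simp add: Y_def algebra_simps)
    \<comment> \<open>Each term has \<phi> or \<psi> among its last two arguments, so all vanish
      where these two covectors do.\<close>
    show "conn (U x) (Y \<psi> x) (\<phi> x) (\<eta> x) + conn (U x) (Y \<eta> x) (\<psi> x) (\<phi> x)
        + conn (U x) (Y \<phi> x) (\<eta> x) (\<psi> x) = 0" if "max R R' \<le> \<bar>x\<bar>"
      using that R[of x] R'[of x] by simp
  qed
qed

lemma hamiltonian_pencil: "hamiltonian_operator phase_space (pencil c)"
  by (simp add: hamiltonian_operator_def pencil_skew_adjoint pencil_jacobi)

lemma bi_hamiltonian_pair_A_op_B_op: "bi_hamiltonian_pair phase_space A_op B_op"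
proof -
  have B: "B_op = pencil 0"
    by (simp add: fun_eq_iff pencil_def)
  have "(\<lambda>U \<psi> x. B_op U \<psi> x + c *\<^sub>R A_op U \<psi> x) = pencil c" for c
    by (simp add: fun_eq_iff pencil_def)
  then show ?thesis
    unfolding bi_hamiltonian_pair_def
    using hamiltonian_A_op hamiltonian_pencil hamiltonian_pencil[of 0, folded B] by simp
qed

section \<open>Variational derivatives and the two forms of the system\<close>

lemma var_deriv_u: "var_deriv u_density U x = axis 1 1"
proof -
  have "((\<lambda>s. U x $ 1 + s * axis j 1 $ 1) has_real_derivative axis j 1 $ 1) (at 0)" for j :: 3
    by (auto intro!: derivative_eq_intros)
  then show ?thesis
    by (auto simp: var_deriv_def u_density_def vec_eq_iff axis_def DERIV_imp_deriv)
qed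

lemma var_deriv_L: "var_deriv L_density U x = - axis 1 1"
proof -
  have "((\<lambda>s. - (U x $ 1 + s * axis j 1 $ 1)) has_real_derivative - (axis j 1 $ 1)) (at 0)" for j :: 3
    by (auto intro!: derivative_eq_intros)
  then show ?thesis
    by (auto simp: var_deriv_def L_density_def u_density_def vec_eq_iff axis_def DERIV_imp_deriv)
qed

text \<open>The contributions of the cutoff \<open>R\<close> cancel by symmetry. With
  \<open>k = -1\<close> this produces the term \<open>- x\<close> of the system.\<close>

lemma dx_inv_const: "dx_inv (\<lambda>_. k) x = k * x"
proof (rule dx_inv_eqI[of "\<bar>x\<bar>"])
  fix R assume "\<bar>x\<bar> \<le> R"
  then have "- R \<le> x" "x \<le> R"
    by linarith+
  then show "(integral {-R..x} (\<lambda>_. k) - integral {x..R} (\<lambda>_. k)) / 2 = k * x"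
    by (simp add: algebra_simps)
qed

lemma var_deriv_F:
  assumes "U x $ 3 \<noteq> 0"
  shows "var_deriv F_density U x =
    vector [U x $ 2, U x $ 1 + 3 * (U x $ 2)^2 / (2 * U x $ 3), - ((U x $ 2)^3 / (2 * (U x $ 3)^2)) - x^2 / 2]"
proof -
  define a b c where "a = U x $ 1" and "b = U x $ 2" and "c = U x $ 3"
  have "((\<lambda>s. (a + s) * b + b^3 / (2 * c) - x^2 / 2 * c) has_real_derivative b) (at 0)"
    by (auto intro!: derivative_eq_intros)
  moreover have "((\<lambda>s. a * (b + s) + (b + s)^3 / (2 * c) - x^2 / 2 * c) has_real_derivative
      a + 3 * b^2 / (2 * c)) (at 0)"
    using assms by (auto intro!: derivative_eq_intros simp: c_def field_simps)
  moreover have "((\<lambda>s. a * b + b^3 / (2 * (c + s)) - x^2 / 2 * (c + s)) has_real_derivative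
      - (b^3 / (2 * c^2)) - x^2 / 2) (at 0)"
    using assms by (auto intro!: derivative_eq_intros simp: c_def field_simps power2_eq_square)
  ultimately show ?thesis
    by (simp add: vec_eq_iff forall_3 var_deriv_def F_density_def Let_def DERIV_imp_deriv
        flip: a_def b_def c_def)
qed

text \<open>The covector is constant, so the metric drops out; what remains is minus the first
  columns of the coefficient matrices and the nonlocal term.\<close>

lemma B_op_L:
  "B_op U (var_deriv L_density U) x = vector
    [- (3 * (U x $ 2)^2 / (2 * (U x $ 3)^2)) * dfield U x $ 2
       + (U x $ 2)^3 / (U x $ 3)^3 * dfield U x $ 3 - x,
     dfield U x $ 1 + 3 * U x $ 2 / U x $ 3 * dfield U x $ 2
       - 3 * (U x $ 2)^2 / (2 * (U x $ 3)^2) * dfield U x $ 3,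
     dfield U x $ 2]"
  unfolding var_deriv_L[abs_def]
  by (simp add: vec_eq_iff forall_3 B_op_def hydro_operator_def sum_3 dx_inv_const dfield_def
      B_metric_def B_coeff_u_def B_coeff_v_def B_coeff_w_def Let_def)

lemma dfield_cong_ev:
  assumes "\<forall>\<^sub>F y in nhds x. U y = V y"
  shows "dfield U x = dfield V x"
  unfolding dfield_def vec_eq_iff vec_lambda_beta
proof
  fix i
  show "deriv (\<lambda>y. U y $ i) x = deriv (\<lambda>y. V y $ i) x"
    by (rule deriv_cong_ev[OF _ refl]) (use assms in eventually_elim, simp)
qed

text \<open>\<open>A\<close> differentiates the variational derivative of \<open>F\<close>, whose
  formula requires a nonzero \<open>w\<close>; hence the condition on a whole neighbourhood of
  \<open>x\<close>.\<close>

lemma A_op_F_eq_B_op_L: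
  assumes U: "(U has_vector_derivative dfield U x) (at x)" and nz: "\<forall>\<^sub>F y in nhds x. U y $ 3 \<noteq> 0"
  shows "A_op U (var_deriv F_density U) x = B_op U (var_deriv L_density U) x"
proof -
  note d = has_vector_derivative_nth[OF U]
  have nz_x: "U x $ 3 \<noteq> 0"
    using nz by (rule eventually_nhds_x_imp_x)
  define V where "V y = (vector [U y $ 2, U y $ 1 + 3 * (U y $ 2)^2 / (2 * U y $ 3),
    - ((U y $ 2)^3 / (2 * (U y $ 3)^2)) - y^2 / 2] :: real ^ 3)" for y
  have "\<forall>\<^sub>F y in nhds x. var_deriv F_density U y = V y"
    using nz by eventually_elim (simp add: var_deriv_F V_def)
  then have "dfield (var_deriv F_density U) x = dfield V x"
    by (rule dfield_cong_ev)
  \<comment> \<open>The components appear in reverse order because \<open>A\<close> exchanges the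
    first and the third.\<close>
  moreover have "(V has_vector_derivative B_op U (var_deriv L_density U) x $ 3 *\<^sub>R axis 1 1
    + B_op U (var_deriv L_density U) x $ 2 *\<^sub>R axis 2 1
    + B_op U (var_deriv L_density U) x $ 1 *\<^sub>R axis 3 1) (at x)"
    unfolding has_vector_derivative_cart_iff forall_3 V_def B_op_L
    using nz_x by (auto intro!: derivative_eq_intros d simp: field_simps power2_eq_square power3_eq_cube)
  ultimately show ?thesis
    by (simp add: A_op_eq dfield_eqI vec_eq_iff forall_3)
qed

theorem theorem6:
  fixes u v w :: "real \<Rightarrow> real \<Rightarrow> real" and D :: "(real \<times> real) set"
  assumes "open D"
    and "\<And>t x. (t, x) \<in> D \<Longrightarrow> u t differentiable (at x)"
    and "\<And>t x. (t, x) \<in> D \<Longrightarrow> v t differentiable (at x)"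
    and "\<And>t x. (t, x) \<in> D \<Longrightarrow> w t differentiable (at x)"
    and "\<And>t x. (t, x) \<in> D \<Longrightarrow> w t x \<noteq> 0"
  shows "bi_hamiltonian_pair phase_space A_op B_op
    \<and> casimir phase_space A_op u_density
    \<and> (\<forall>(t, x)\<in>D. A_op (state u v w t) (var_deriv F_density (state u v w t)) x
                  = B_op (state u v w t) (var_deriv L_density (state u v w t)) x)
    \<and> (solves_system D u v w
         \<longleftrightarrow> evolves_by D (\<lambda>U. A_op U (var_deriv F_density U)) (state u v w))
    \<and> (solves_system D u v w
         \<longleftrightarrow> evolves_by D (\<lambda>U. B_op U (var_deriv L_density U)) (state u v w))"
proof -
  have "casimir phase_space A_op u_density"
    unfolding casimir_def var_deriv_u[abs_def]
    by (simp add: A_op_eq dfield_def vec_eq_iff forall_3)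
  moreover have AB: "A_op (state u v w t) (var_deriv F_density (state u v w t)) x
      = B_op (state u v w t) (var_deriv L_density (state u v w t)) x" if tx: "(t, x) \<in> D" for t x
  proof (rule A_op_F_eq_B_op_L)
    show "(state u v w t has_vector_derivative dfield (state u v w t) x) (at x)"
      using assms(2-4)[OF tx]
      by (simp add: has_vector_derivative_cart_iff forall_3 dfield_def state_def
          DERIV_deriv_iff_real_differentiable)
    \<comment> \<open>Openness of \<open>D\<close> provides nonvanishing \<open>w\<close> near
      \<open>x\<close> at fixed time.\<close>
    have "open (Pair t -` D)"
      using assms(1) by (rule open_vimage) (intro continuous_intros)
    then have "\<forall>\<^sub>F y in nhds x. (t, y) \<in> D"
      using eventually_nhds_in_open[of "Pair t -` D" x] tx by simp
    then show "\<forall>\<^sub>F y in nhds x. state u v w t y $ 3 \<noteq> 0"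
      by eventually_elim (simp add: state_def assms(5))
  qed
  moreover have B: "solves_system D u v w
      \<longleftrightarrow> evolves_by D (\<lambda>U. B_op U (var_deriv L_density U)) (state u v w)"
    unfolding solves_system_def evolves_by_def has_vector_derivative_cart_iff forall_3 B_op_L
    by (simp add: state_def dfield_def)
  moreover have "evolves_by D (\<lambda>U. A_op U (var_deriv F_density U)) (state u v w)
      \<longleftrightarrow> evolves_by D (\<lambda>U. B_op U (var_deriv L_density U)) (state u v w)"
    unfolding evolves_by_def by (intro ball_cong refl) (auto simp: AB)
  ultimately show ?thesis
    using bi_hamiltonian_pair_A_op_B_op by blast
qed

end
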